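(* Let $n$ be a positive integer. There exists a complete set of mutually orthogonal Latin squares of order $n$ if and only if $\bar{R}(n+1;n+1)=n^2+1$.
   Context: A complete set of mutually orthogonal Latin squares (MOLS) of order $n$ is a set of $n-1$ pairwise orthogonal Latin squares of order $n$; equivalently, an edge-coloring $f$ of $K_{n^2}$ with $n+1$ colors such that each color class $f^{-1}(i)$ is isomorphic to $nK_n$ (disjoint union of $n$ copies of $K_n$). For a positive integer $N$, $[N]=\{1,\dots,N\}$. An edge-coloring of $K_N$ with $k$ colors is a map $f:\binom{[N]}{2}\to[k]$; $\alpha_i(f)$ is the independence number of the graph on $[N]$ whose edges are the pairs of color $i$. For positive integers $m_1,\dots,m_k$, $\bar{R}(m_1,\dots,m_k)$ is the least positive integer $N$ such that every edge-coloring $f$ of $K_N$ with $k$ colors has some $i\in[k]$ with $\alpha_i(f)\ge m_i$; $\bar{R}(m;k)$ denotes $\bar{R}(m,\dots,m)$ with $k$ arguments. *)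

theory Defs
  imports "HOL-Library.Ramsey" "HOL-Library.FuncSet"
begin

definition latin_square :: "nat \<Rightarrow> (nat \<times> nat \<Rightarrow> nat) \<Rightarrow> bool" where
  "latin_square n L \<longleftrightarrow>
     L \<in> {1..n} \<times> {1..n} \<rightarrow>\<^sub>E {1..n} \<and>
     (\<forall>r\<in>{1..n}. bij_betw (\<lambda>c. L (r, c)) {1..n} {1..n}) \<and>
     (\<forall>c\<in>{1..n}. bij_betw (\<lambda>r. L (r, c)) {1..n} {1..n})"

definition orthogonal_squares :: "nat \<Rightarrow> (nat \<times> nat \<Rightarrow> nat) \<Rightarrow> (nat \<times> nat \<Rightarrow> nat) \<Rightarrow> bool" where
  "orthogonal_squares n L M \<longleftrightarrow>
     bij_betw (\<lambda>p. (L p, M p)) ({1..n} \<times> {1..n}) ({1..n} \<times> {1..n})"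

text \<open>The finiteness condition matters for \<open>n = 1\<close>, as infinite sets have cardinality \<open>0\<close>.\<close>

definition complete_MOLS :: "nat \<Rightarrow> (nat \<times> nat \<Rightarrow> nat) set \<Rightarrow> bool" where
  "complete_MOLS n S \<longleftrightarrow>
     finite S \<and> card S = n - 1 \<and> (\<forall>L\<in>S. latin_square n L) \<and> pairwise (orthogonal_squares n) S"

definition independence_number :: "'a set \<Rightarrow> 'a set set \<Rightarrow> nat" where
  "independence_number V E = Max (card ` {S. S \<subseteq> V \<and> indep S E})"

definition edge_coloring :: "nat \<Rightarrow> nat \<Rightarrow> (nat set \<Rightarrow> nat) \<Rightarrow> bool" where
  "edge_coloring N k f \<longleftrightarrow> f \<in> [{1..N}]\<^bsup>2\<^esup> \<rightarrow> {1..k}"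

definition color_alpha :: "nat \<Rightarrow> (nat set \<Rightarrow> nat) \<Rightarrow> nat \<Rightarrow> nat" where
  "color_alpha N f i = independence_number {1..N} {e \<in> [{1..N}]\<^bsup>2\<^esup>. f e = i}"

text \<open>The parameters \<open>m\<^sub>1, \<dots>, m\<^sub>k\<close> are the values \<open>m 1, \<dots>, m k\<close> of a function.
  For \<open>k \<ge> 2\<close> a suitable \<open>N\<close> exists by Ramsey's theorem, since a clique in one color is
  independent in every other color.\<close>

definition Rbar :: "nat \<Rightarrow> (nat \<Rightarrow> nat) \<Rightarrow> nat" where
  "Rbar k m = (LEAST N. 0 < N \<and>
     (\<forall>f. edge_coloring N k f \<longrightarrow> (\<exists>i\<in>{1..k}. m i \<le> color_alpha N f i)))"

definition Rbar_diag :: "nat \<Rightarrow> nat \<Rightarrow> nat" where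
  "Rbar_diag m k = Rbar k (\<lambda>_. m)"

end

theory Submission
  imports Defs
begin

text \<open>Let every color class of an edge-coloring of \<open>K\<^sub>N\<close> with \<open>n + 1\<close> colors have independence
  number at most \<open>n\<close>. Turan's theorem bounds the size of each class from below, and summing over the
  classes gives \<open>N \<le> n\<^sup>2\<close>. For \<open>N = n\<^sup>2\<close> all these bounds are attained, so every class is a
  disjoint union of at most \<open>n\<close> cliques. Numbering the cliques gives \<open>n + 1\<close> labels
  for each vertex, and two vertices agree in the label of at most one color. Such a labelling is the
  same as a complete set of MOLS: two of the labels serve as row and column,
  and the others are the entries of the squares.\<close>

subsection \<open>Turan's bound for reflexive symmetric relations\<close>

text \<open>Ordered pairs, diagonal included: for a reflexive symmetric relation this is the number
  of vertices plus twice the number of edges. With this count Turan's bound needs neither division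
  nor subtraction.\<close>

definition rel_pairs :: "'a set \<Rightarrow> ('a \<Rightarrow> 'a \<Rightarrow> bool) \<Rightarrow> nat" where
  "rel_pairs V R = card {p \<in> V \<times> V. R (fst p) (snd p)}"

definition rel_indep :: "('a \<Rightarrow> 'a \<Rightarrow> bool) \<Rightarrow> 'a set \<Rightarrow> bool" where
  "rel_indep R S \<longleftrightarrow> (\<forall>x\<in>S. \<forall>y\<in>S. x \<noteq> y \<longrightarrow> \<not> R x y)"

lemma rel_pairs_eq_sum:
  assumes "finite V"
  shows "rel_pairs V R = (\<Sum>x\<in>V. \<Sum>y\<in>V. of_bool (R x y))"
proof -
  have "rel_pairs V R = (\<Sum>p\<in>V \<times> V. of_bool (R (fst p) (snd p)))"
    using assms unfolding rel_pairs_def by (simp add: of_bool_def sum.If_cases Int_def)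
  also have "\<dots> = (\<Sum>x\<in>V. \<Sum>y\<in>V. of_bool (R x y))"
    by (simp add: sum.cartesian_product case_prod_beta)
  finally show ?thesis .
qed

text \<open>The pairs split into four blocks according to which entries lie in \<open>I\<close>.
  Inside \<open>I\<close> only the diagonal survives, and the two mixed blocks have equal size by
  symmetry.\<close>

lemma rel_pairs_remove_indep:
  assumes fin: "finite V" and refl: "\<And>x. R x x" and sym: "\<And>x y. R x y \<Longrightarrow> R y x"
    and I: "I \<subseteq> V" "rel_indep R I"
  shows "rel_pairs V R
    = rel_pairs (V - I) R + card I + 2 * (\<Sum>y\<in>V - I. \<Sum>x\<in>I. of_bool (R x y))"
proof -
  let ?W = "V - I"
  let ?q = "\<lambda>A B. \<Sum>x\<in>A. \<Sum>y\<in>B. of_bool (R x y) :: nat"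
  have finI: "finite I" using I(1) fin finite_subset by blast
  have split: "sum h V = sum h I + sum h ?W" for h :: "'a \<Rightarrow> nat"
    by (metis I(1) add.commute fin sum.subset_diff)
  have "?q V V = ?q I I + ?q I ?W + (?q ?W I + ?q ?W ?W)"
    by (simp add: split sum.distrib)
  moreover have "?q I I = card I"
  proof -
    have "(\<Sum>y\<in>I. of_bool (R x y)) = (1::nat)" if "x \<in> I" for x
    proof -
      have "(\<Sum>y\<in>I. of_bool (R x y)) = (\<Sum>y\<in>I. of_bool (x = y) :: nat)"
        using that I(2) refl unfolding rel_indep_def by (intro sum.cong) auto
      also have "\<dots> = 1" using that finI by (simp add: of_bool_def)
      finally show ?thesis .
    qed
    then show ?thesis by simp
  qed
  moreover have "?q ?W I = (\<Sum>y\<in>?W. \<Sum>x\<in>I. of_bool (R x y))"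
    using sym by (intro sum.cong HOL.refl arg_cong[where f = of_bool]) blast+
  moreover have "?q I ?W = (\<Sum>y\<in>?W. \<Sum>x\<in>I. of_bool (R x y))"
    by (rule sum.swap)
  ultimately show ?thesis
    using fin by (simp add: rel_pairs_eq_sum)
qed

text \<open>An inclusion-maximal independent set above \<open>J\<close> works: an outside vertex
  without a neighbour in it could be added.\<close>

lemma rel_indep_extend_maximal:
  assumes fin: "finite V" and sym: "\<And>x y. R x y \<Longrightarrow> R y x"
    and J: "J \<subseteq> V" "rel_indep R J"
  obtains I where "J \<subseteq> I" "I \<subseteq> V" "rel_indep R I" "\<And>y. y \<in> V - I \<Longrightarrow> \<exists>x\<in>I. R x y"
proof -
  let ?F = "{I. I \<subseteq> V \<and> rel_indep R I}"
  have "finite ?F" using fin by simp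
  moreover have "J \<in> ?F" using J by simp
  ultimately obtain I where I: "I \<in> ?F" "J \<subseteq> I" and max: "\<forall>K\<in>?F. I \<subseteq> K \<longrightarrow> I = K"
    by (rule finite_has_maximal2[THEN bexE]) simp
  have "\<exists>x\<in>I. R x y" if y: "y \<in> V - I" for y
  proof (rule ccontr)
    assume "\<not> ?thesis"
    then have "insert y I \<in> ?F"
      using I(1) y sym unfolding rel_indep_def by blast
    then show False using max y by blast
  qed
  then show ?thesis using that I by blast
qed

text \<open>The inductive step of Turan's bound in numbers: removing an independent set of size
  \<open>b\<close> from \<open>N\<close> vertices leaves \<open>W\<close> vertices with
  \<open>q\<close> related pairs, and \<open>s\<close> counts the related pairs between the two
  parts. Expand \<open>(W + b)\<^sup>2\<close> and use \<open>b \<le> a\<close>. The slack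
  \<open>2 * a * (s - W)\<close> is kept for the equality case.\<close>

lemma turan_arith:
  fixes N a b s q W :: nat
  assumes "W + b = N" "b \<le> a" "W\<^sup>2 \<le> a * q" "W \<le> s"
  shows "N\<^sup>2 + 2 * a * (s - W) \<le> a * (q + b + 2 * s)"
proof -
  obtain c where c: "a = b + c" using assms(2) le_Suc_ex by blast
  obtain d where d: "s = W + d" using assms(4) le_Suc_ex by blast
  have "N\<^sup>2 + 2 * a * (s - W) = W\<^sup>2 + 2 * W * b + b\<^sup>2 + 2 * a * d"
    using assms(1) d by (auto simp: power2_eq_square algebra_simps)
  also have "\<dots> \<le> a * q + 2 * W * a + a * b + 2 * a * d"
    using assms(3) c by (simp add: power2_eq_square algebra_simps)
  also have "\<dots> = a * (q + b + 2 * s)"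
    by (simp add: d algebra_simps)
  finally show ?thesis .
qed

lemma sum_of_bool_ge_1:
  assumes "finite I" "\<exists>x\<in>I. P x"
  shows "1 \<le> (\<Sum>x\<in>I. of_bool (P x) :: nat)"
proof -
  obtain x where "x \<in> I" "P x" using assms(2) by blast
  then show ?thesis
    using member_le_sum[of x I "\<lambda>x. of_bool (P x) :: nat"] assms(1) by simp
qed

text \<open>Induction by removing a maximal independent set \<open>I\<close>: every vertex outside
  has a neighbour in \<open>I\<close>, so at least \<open>card (V - I)\<close> related pairs run
  between \<open>I\<close> and the rest.\<close>

lemma turan_bound:
  assumes "finite V" and refl: "\<And>x. R x x" and sym: "\<And>x y. R x y \<Longrightarrow> R y x"
    and "\<And>S. S \<subseteq> V \<Longrightarrow> rel_indep R S \<Longrightarrow> card S \<le> a"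
  shows "(card V)\<^sup>2 \<le> a * rel_pairs V R"
  using assms(1,4)
proof (induction V rule: finite_psubset_induct)
  case (psubset V)
  show ?case
  proof (cases "V = {}")
    case True
    then show ?thesis by simp
  next
    case False
    then obtain v where v: "v \<in> V" by blast
    \<comment> \<open>Starting from \<open>{v}\<close> makes \<open>I\<close> nonempty, so the
      induction hypothesis applies to \<open>V - I\<close>.\<close>
    obtain I where I: "{v} \<subseteq> I" "I \<subseteq> V" "rel_indep R I"
      and max: "\<And>y. y \<in> V - I \<Longrightarrow> \<exists>x\<in>I. R x y"
      by (rule rel_indep_extend_maximal[of V R "{v}"])
        (use psubset.hyps sym v in \<open>auto simp: rel_indep_def\<close>)
    have finI: "finite I" using I(2) psubset.hyps finite_subset by blast
    have IH: "(card (V - I))\<^sup>2 \<le> a * rel_pairs (V - I) R"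
      by (rule psubset.IH) (use I v psubset.prems in auto)
    have le: "card (V - I) \<le> (\<Sum>y\<in>V - I. \<Sum>x\<in>I. of_bool (R x y) :: nat)"
      using sum_mono[of "V - I" "\<lambda>_. 1", OF sum_of_bool_ge_1[OF finI max]] by simp
    have "card (V - I) + card I = card V"
      using I(2) psubset.hyps finI by (simp add: card_Diff_subset card_mono)
    from turan_arith[OF this _ IH le] show ?thesis
      using rel_pairs_remove_indep[OF psubset.hyps refl sym I(2,3)] psubset.prems[OF I(2,3)]
      by simp
  qed
qed

text \<open>If \<open>x\<close> and \<open>z\<close> were unrelated, \<open>{x, z}\<close> would
  extend to a maximal independent set. Then \<open>y\<close> has two neighbours in it, so the slack
  in \<open>turan_arith\<close> is positive and equality fails. Hence the extremal graphs are
  disjoint unions of cliques.\<close>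

lemma turan_equality_transitive:
  assumes fin: "finite V" and refl: "\<And>x. R x x" and sym: "\<And>x y. R x y \<Longrightarrow> R y x"
    and alpha: "\<And>S. S \<subseteq> V \<Longrightarrow> rel_indep R S \<Longrightarrow> card S \<le> a"
    and eq: "a * rel_pairs V R \<le> (card V)\<^sup>2" and "0 < a"
    and xyz: "x \<in> V" "y \<in> V" "z \<in> V" "R x y" "R y z"
  shows "R x z"
proof (rule ccontr)
  assume nR: "\<not> R x z"
  then have "x \<noteq> z" using refl by auto
  obtain I where I: "{x, z} \<subseteq> I" "I \<subseteq> V" "rel_indep R I"
    and max: "\<And>y. y \<in> V - I \<Longrightarrow> \<exists>x\<in>I. R x y"
    by (rule rel_indep_extend_maximal[of V R "{x, z}"])
      (use fin sym xyz nR in \<open>auto simp: rel_indep_def\<close>)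
  have finI: "finite I" using I(2) fin finite_subset by blast
  have "y \<notin> I" using I(1,3) xyz nR unfolding rel_indep_def by (metis insert_subset)
  let ?c = "\<lambda>y. \<Sum>x\<in>I. of_bool (R x y) :: nat"
  \<comment> \<open>The neighbours \<open>x\<close> and \<open>z\<close> of \<open>y\<close> both
    lie in \<open>I\<close>, so \<open>y\<close> is counted at least twice.\<close>
  have "(\<Sum>u\<in>{x, z}. of_bool (R u y)) \<le> ?c y"
    using I(1) finI by (intro sum_mono2) auto
  then have "1 < ?c y" using xyz sym \<open>x \<noteq> z\<close> by simp
  then have "(\<Sum>y\<in>V - I. 1) < (\<Sum>y\<in>V - I. ?c y)"
    using fin xyz(2) \<open>y \<notin> I\<close>
    by (intro sum_strict_mono_ex1 ballI sum_of_bool_ge_1[OF finI max]) auto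
  then have less: "card (V - I) < (\<Sum>y\<in>V - I. ?c y)" by simp
  have IH: "(card (V - I))\<^sup>2 \<le> a * rel_pairs (V - I) R"
    by (rule turan_bound[OF finite_Diff[OF fin] refl sym]) (use alpha in blast)+
  have "card (V - I) + card I = card V"
    using I(2) fin finI by (simp add: card_Diff_subset card_mono)
  from turan_arith[OF this alpha[OF I(2,3)] IH less_imp_le[OF less]]
  have "(card V)\<^sup>2 + 2 * a * ((\<Sum>y\<in>V - I. ?c y) - card (V - I)) \<le> a * rel_pairs V R"
    using rel_pairs_remove_indep[OF fin refl sym I(2,3)] by simp
  moreover have "0 < 2 * a * ((\<Sum>y\<in>V - I. ?c y) - card (V - I))"
    using less \<open>0 < a\<close> by simp
  ultimately show False using eq by linarith
qed

text \<open>A maximal independent set meets every clique and has at most \<open>a\<close> elements.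
  Each vertex gets the number of a representative related to it; equal labels mean a common
  representative, and transitivity connects the two vertices through it.\<close>

lemma transitive_relation_labels:
  assumes fin: "finite V" and refl: "\<And>x. R x x" and sym: "\<And>x y. R x y \<Longrightarrow> R y x"
    and trans: "\<And>x y z. x \<in> V \<Longrightarrow> y \<in> V \<Longrightarrow> z \<in> V \<Longrightarrow> R x y \<Longrightarrow> R y z \<Longrightarrow> R x z"
    and alpha: "\<And>S. S \<subseteq> V \<Longrightarrow> rel_indep R S \<Longrightarrow> card S \<le> a"
  shows "\<exists>g. g \<in> V \<rightarrow> {1..a} \<and> (\<forall>x\<in>V. \<forall>y\<in>V. g x = g y \<longrightarrow> R x y)"
proof -
  obtain I where I: "{} \<subseteq> I" "I \<subseteq> V" "rel_indep R I"
    and max: "\<And>y. y \<in> V - I \<Longrightarrow> \<exists>x\<in>I. R x y"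
    by (rule rel_indep_extend_maximal[of V R "{}"])
      (use fin sym in \<open>auto simp: rel_indep_def\<close>)
  have "\<forall>y\<in>V. \<exists>x\<in>I. R x y" using max refl by blast
  then obtain rep where rep: "\<And>y. y \<in> V \<Longrightarrow> rep y \<in> I \<and> R (rep y) y"
    by metis
  have "finite I" using I(2) fin finite_subset by blast
  moreover have "card I \<le> card {1..a}" using alpha I by simp
  ultimately obtain h where h: "h ` I \<subseteq> {1..a}" "inj_on h I"
    using card_le_inj[of I "{1..a}"] by auto
  have "R x y" if "x \<in> V" "y \<in> V" "h (rep x) = h (rep y)" for x y
  proof -
    have "rep x = rep y" using h(2) that rep by (meson inj_onD)
    then show ?thesis using rep that sym trans I(2) by (metis subsetD)
  qed
  moreover have "(\<lambda>x. h (rep x)) \<in> V \<rightarrow> {1..a}" using h rep by blast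
  ultimately show ?thesis by blast
qed

subsection \<open>Colorings with small independence numbers\<close>

text \<open>A color class with the diagonal added, which makes it reflexive as Turan's bound
  requires.\<close>

definition color_rel :: "(nat set \<Rightarrow> nat) \<Rightarrow> nat \<Rightarrow> nat \<Rightarrow> nat \<Rightarrow> bool" where
  "color_rel f i x y \<longleftrightarrow> x = y \<or> f {x, y} = i"

lemma color_rel_refl: "color_rel f i x x"
  by (simp add: color_rel_def)

lemma color_rel_sym: "color_rel f i x y \<Longrightarrow> color_rel f i y x"
  by (auto simp: color_rel_def insert_commute)

text \<open>The maximum is taken over a nonempty finite set, since the empty set is independent; it
  is below \<open>m\<close> exactly when all its members are.\<close>

lemma color_alpha_less_iff:
  "color_alpha N f i < m \<longleftrightarrow> (\<forall>S. S \<subseteq> {1..N} \<longrightarrow> rel_indep (color_rel f i) S \<longrightarrow> card S < m)"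
proof -
  let ?E = "{e \<in> [{1..N}]\<^bsup>2\<^esup>. f e = i}"
  have "indep S ?E \<longleftrightarrow> rel_indep (color_rel f i) S" if "S \<subseteq> {1..N}" for S
    using that unfolding indep_def rel_indep_def color_rel_def nsets_def
    by (auto simp: subset_iff)
  then have *: "{S. S \<subseteq> {1..N} \<and> indep S ?E} = {S. S \<subseteq> {1..N} \<and> rel_indep (color_rel f i) S}"
    by blast
  have "{} \<in> {S. S \<subseteq> {1..N} \<and> rel_indep (color_rel f i) S}" by (simp add: rel_indep_def)
  then have ne: "card ` {S. S \<subseteq> {1..N} \<and> rel_indep (color_rel f i) S} \<noteq> {}" by blast
  show ?thesis
    unfolding color_alpha_def independence_number_def *
    by (subst Max_less_iff) (use ne in auto)
qed

text \<open>Each of the \<open>N * (N - 1)\<close> off-diagonal pairs has exactly one color, while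
  each of the \<open>N\<close> diagonal pairs is counted for all \<open>k\<close> colors. The
  summand \<open>N\<close> on the left avoids a subtraction.\<close>

lemma sum_color_rel_pairs:
  assumes "edge_coloring N k f"
  shows "(\<Sum>i\<in>{1..k}. rel_pairs {1..N} (color_rel f i)) + N = N * (N + k)"
proof -
  have inner: "(\<Sum>i\<in>{1..k}. of_bool (color_rel f i x y)) = (if x = y then k else 1)"
    if "x \<in> {1..N}" "y \<in> {1..N}" for x y
  proof (cases "x = y")
    case True
    then show ?thesis by (simp add: color_rel_def)
  next
    case False
    then have "{x, y} \<in> [{1..N}]\<^bsup>2\<^esup>" using that by (simp add: nsets_def)
    then have "f {x, y} \<in> {1..k}" using assms unfolding edge_coloring_def by blast
    then show ?thesis using False by (simp add: color_rel_def of_bool_def)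
  qed
  have row: "(\<Sum>y\<in>{1..N}. if x = y then k else 1) + 1 = N + k" if "x \<in> {1..N}" for x
  proof -
    have "(\<Sum>y\<in>{1..N}. if x = y then k else 1) = k + (\<Sum>y\<in>{1..N} - {x}. 1)"
      using that by (subst sum.remove[of _ x]) (auto intro!: sum.cong)
    then show ?thesis using that by simp
  qed
  have "(\<Sum>i\<in>{1..k}. rel_pairs {1..N} (color_rel f i))
      = (\<Sum>i\<in>{1..k}. \<Sum>x\<in>{1..N}. \<Sum>y\<in>{1..N}. of_bool (color_rel f i x y))"
    by (simp add: rel_pairs_eq_sum)
  also have "\<dots> = (\<Sum>x\<in>{1..N}. \<Sum>i\<in>{1..k}. \<Sum>y\<in>{1..N}. of_bool (color_rel f i x y))"
    by (rule sum.swap)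
  also have "\<dots> = (\<Sum>x\<in>{1..N}. \<Sum>y\<in>{1..N}. \<Sum>i\<in>{1..k}. of_bool (color_rel f i x y))"
    by (intro sum.cong refl sum.swap)
  also have "\<dots> = (\<Sum>x\<in>{1..N}. \<Sum>y\<in>{1..N}. if x = y then k else 1)"
    by (intro sum.cong refl inner)
  finally have "(\<Sum>i\<in>{1..k}. rel_pairs {1..N} (color_rel f i)) + N
      = (\<Sum>x\<in>{1..N}. (\<Sum>y\<in>{1..N}. if x = y then k else 1) + 1)"
    by (simp only: sum.distrib) simp
  also have "\<dots> = (\<Sum>x\<in>{1..N}. N + k)"
    by (intro sum.cong refl row)
  finally show ?thesis by simp
qed

lemma color_class_turan_bound:
  assumes "color_alpha N f i < n + 1"
  shows "N\<^sup>2 \<le> n * rel_pairs {1..N} (color_rel f i)"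
proof -
  have "(card {1..N})\<^sup>2 \<le> n * rel_pairs {1..N} (color_rel f i)"
    by (rule turan_bound)
      (use assms color_rel_refl color_rel_sym in
        \<open>auto simp: color_alpha_less_iff simp flip: less_Suc_eq_le\<close>)
  then show ?thesis by simp
qed

text \<open>Adding the Turan bounds of the \<open>n + 1\<close> classes gives
  \<open>(n + 1) * N\<^sup>2 \<le> n * (N * (N + n))\<close>, which reduces to
  \<open>N\<^sup>2 \<le> N * n\<^sup>2\<close>.\<close>

lemma coloring_order_le_square:
  assumes "edge_coloring N (n + 1) f" "\<forall>i\<in>{1..n+1}. color_alpha N f i < n + 1"
  shows "N \<le> n\<^sup>2"
proof (cases "N = 0")
  case False
  have "(n + 1) * N\<^sup>2 = (\<Sum>i\<in>{1..n+1}. N\<^sup>2)" by simp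
  also have "\<dots> \<le> (\<Sum>i\<in>{1..n+1}. n * rel_pairs {1..N} (color_rel f i))"
    using assms(2) by (intro sum_mono color_class_turan_bound) blast
  also have "\<dots> = n * (\<Sum>i\<in>{1..n+1}. rel_pairs {1..N} (color_rel f i))"
    by (rule sum_distrib_left[symmetric])
  also have "\<dots> = n * (N * (N + n))"
    using sum_color_rel_pairs[OF assms(1)] by (simp add: algebra_simps)
  finally have "N * N \<le> N * n\<^sup>2"
    by (simp add: power2_eq_square algebra_simps)
  then show ?thesis using False by simp
qed simp

text \<open>For \<open>n\<^sup>2\<close> vertices the lower bounds and the actual values have the
  same sum over all colors, so they agree color by color.\<close>

lemma color_class_turan_equality:
  assumes "edge_coloring (n\<^sup>2) (n + 1) f" "\<forall>i\<in>{1..n+1}. color_alpha (n\<^sup>2) f i < n + 1"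
    and "i \<in> {1..n+1}"
  shows "n * rel_pairs {1..n\<^sup>2} (color_rel f i) = (n\<^sup>2)\<^sup>2"
proof -
  let ?q = "\<lambda>i. n * rel_pairs {1..n\<^sup>2} (color_rel f i)"
  have ge: "(n\<^sup>2)\<^sup>2 \<le> ?q j" if "j \<in> {1..n+1}" for j
    using assms(2) that by (intro color_class_turan_bound) blast
  have "sum ?q {1..n+1} = n * (\<Sum>i\<in>{1..n+1}. rel_pairs {1..n\<^sup>2} (color_rel f i))"
    by (rule sum_distrib_left[symmetric])
  also have "\<dots> = n * (n\<^sup>2 * (n\<^sup>2 + n))"
    using sum_color_rel_pairs[OF assms(1)] by (simp add: algebra_simps)
  also have "\<dots> = (\<Sum>i\<in>{1..n+1}. (n\<^sup>2)\<^sup>2)"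
    by (simp add: power2_eq_square algebra_simps)
  finally have eq: "(\<Sum>i\<in>{1..n+1}. (n\<^sup>2)\<^sup>2) = sum ?q {1..n+1}" by simp
  show ?thesis
    using sum_mono_inv[OF eq ge assms(3)] by simp
qed

subsection \<open>Orthogonal labellings\<close>

text \<open>For \<open>n\<^sup>2\<close> elements this is an orthogonal array of strength 2 with
  \<open>k\<close> factors and \<open>n\<close> levels, or a \<open>k\<close>-net whose parallel
  classes are the level sets. Injectivity suffices, as counting then yields bijectivity.\<close>

definition orthogonal_labels :: "nat \<Rightarrow> nat \<Rightarrow> 'a set \<Rightarrow> (nat \<Rightarrow> 'a \<Rightarrow> nat) \<Rightarrow> bool" where
  "orthogonal_labels n k V g \<longleftrightarrow>
     (\<forall>i\<in>{1..k}. g i \<in> V \<rightarrow> {1..n}) \<and>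
     (\<forall>i\<in>{1..k}. \<forall>j\<in>{1..k}. i \<noteq> j \<longrightarrow> inj_on (\<lambda>x. (g i x, g j x)) V)"

text \<open>Equality in Turan's bound makes every color class transitive, so its cliques can be
  numbered. Distinct vertices agreeing in two labels would be joined by an edge of two
  colors.\<close>

lemma orthogonal_labels_of_coloring:
  assumes "0 < n"
    and "edge_coloring (n\<^sup>2) (n + 1) f" "\<forall>i\<in>{1..n+1}. color_alpha (n\<^sup>2) f i < n + 1"
  shows "\<exists>g. orthogonal_labels n (n + 1) {1..n\<^sup>2} g"
proof -
  let ?V = "{1..n\<^sup>2}"
  have "\<forall>i\<in>{1..n+1}. \<exists>g. g \<in> ?V \<rightarrow> {1..n} \<and>
      (\<forall>x\<in>?V. \<forall>y\<in>?V. g x = g y \<longrightarrow> color_rel f i x y)"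
  proof
    fix i assume i: "i \<in> {1..n+1}"
    have alpha: "card S \<le> n" if "S \<subseteq> ?V" "rel_indep (color_rel f i) S" for S
      using assms(3) i that unfolding color_alpha_less_iff by (metis Suc_eq_plus1 less_Suc_eq_le)
    have trans: "color_rel f i x z"
      if "x \<in> ?V" "y \<in> ?V" "z \<in> ?V" "color_rel f i x y" "color_rel f i y z" for x y z
      by (rule turan_equality_transitive[of ?V "color_rel f i" n x y z])
        (use that alpha assms(1) color_class_turan_equality[OF assms(2,3) i]
          color_rel_refl color_rel_sym in auto)
    show "\<exists>g. g \<in> ?V \<rightarrow> {1..n} \<and> (\<forall>x\<in>?V. \<forall>y\<in>?V. g x = g y \<longrightarrow> color_rel f i x y)"
      by (rule transitive_relation_labels
          [OF finite_atLeastAtMost color_rel_refl color_rel_sym trans alpha])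
  qed
  then obtain g where g: "\<And>i. i \<in> {1..n+1} \<Longrightarrow> g i \<in> ?V \<rightarrow> {1..n} \<and>
      (\<forall>x\<in>?V. \<forall>y\<in>?V. g i x = g i y \<longrightarrow> color_rel f i x y)"
    by metis
  have "inj_on (\<lambda>x. (g i x, g j x)) ?V"
    if ij: "i \<in> {1..n+1}" "j \<in> {1..n+1}" "i \<noteq> j" for i j
  proof (rule inj_onI)
    fix x y assume "x \<in> ?V" "y \<in> ?V" "(g i x, g j x) = (g i y, g j y)"
    then have "color_rel f i x y" "color_rel f j x y" using g ij by auto
    then show "x = y" using ij(3) by (auto simp: color_rel_def)
  qed
  with g have "orthogonal_labels n (n + 1) ?V g"
    unfolding orthogonal_labels_def by simp
  then show ?thesis by blast
qed

text \<open>Color a pair by an index at which its labels agree; orthogonality makes this index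
  unique. Independent sets of color \<open>i\<close> then have distinct \<open>i\<close>-th labels,
  hence at most \<open>n\<close> elements.\<close>

lemma coloring_of_orthogonal_labels:
  assumes g: "orthogonal_labels n k {1..N} g" and "0 < k"
  shows "\<exists>f. edge_coloring N k f \<and> (\<forall>i\<in>{1..k}. color_alpha N f i < n + 1)"
proof -
  let ?P = "\<lambda>e i. i \<in> {1..k} \<and> (\<forall>x\<in>e. \<forall>y\<in>e. g i x = g i y)"
  \<comment> \<open>Sets with no agreeing index get the default color 1, which is legal since
    \<open>0 < k\<close>; additional edges create no new independent sets.\<close>
  define f where "f e = (if \<exists>i. ?P e i then SOME i. ?P e i else 1)" for e
  have "f e \<in> {1..k}" for e
  proof (cases "\<exists>i. ?P e i")
    case True
    then have "?P e (SOME i. ?P e i)" by (rule someI_ex)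
    with True show ?thesis unfolding f_def by simp
  next
    case False
    then show ?thesis unfolding f_def using assms(2) by auto
  qed
  then have col: "edge_coloring N k f" by (simp add: edge_coloring_def)
  have f_eq: "f {x, y} = i"
    if "x \<in> {1..N}" "y \<in> {1..N}" "x \<noteq> y" "i \<in> {1..k}" "g i x = g i y" for x y i
  proof -
    have P: "?P {x, y} i" using that by simp
    then have "f {x, y} = (SOME i. ?P {x, y} i)"
      unfolding f_def by (intro if_P exI)
    then have P': "?P {x, y} (f {x, y})"
      using someI[of "?P {x, y}", OF P] by metis
    show ?thesis
    proof (rule ccontr)
      assume "f {x, y} \<noteq> i"
      then have "inj_on (\<lambda>u. (g (f {x, y}) u, g i u)) {1..N}"
        using g P P' unfolding orthogonal_labels_def by blast
      then show False using that P' by (auto dest: inj_onD)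
    qed
  qed
  have "card S < n + 1" if i: "i \<in> {1..k}" and S: "S \<subseteq> {1..N}" "rel_indep (color_rel f i) S"
    for i S
  proof -
    have "inj_on (g i) S"
      using S f_eq i unfolding rel_indep_def color_rel_def inj_on_def by (metis subsetD)
    moreover have "g i ` S \<subseteq> {1..n}" using g i S(1) unfolding orthogonal_labels_def by blast
    ultimately have "card S \<le> card {1..n}" by (intro card_inj_on_le) auto
    then show ?thesis by simp
  qed
  then have "\<forall>i\<in>{1..k}. color_alpha N f i < n + 1"
    unfolding color_alpha_less_iff by blast
  with col show ?thesis by blast
qed

section \<open>Orthogonal labellings and Latin squares\<close>

text \<open>A cell is labelled by its entries in the \<open>n - 1\<close> squares, its row and its
  column. Two squares separate cells by orthogonality, a square and a coordinate by the Latin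
  property.\<close>

lemma orthogonal_labels_of_MOLS:
  assumes "0 < n" "complete_MOLS n S"
  shows "\<exists>g. orthogonal_labels n (n + 1) ({1..n} \<times> {1..n}) g"
proof -
  let ?V = "{1..n} \<times> {1..n}"
  have S: "finite S" "card S = n - 1" "\<And>L. L \<in> S \<Longrightarrow> latin_square n L"
    and orth: "\<And>L M. L \<in> S \<Longrightarrow> M \<in> S \<Longrightarrow> L \<noteq> M \<Longrightarrow> orthogonal_squares n L M"
    using assms(2) unfolding complete_MOLS_def by (auto dest: pairwiseD)
  have "card {1..<n} = card S" using S(2) by simp
  then obtain h where h: "bij_betw h {1..<n} S"
    using S(1) finite_same_card_bij by blast
  \<comment> \<open>Indices below \<open>n\<close> enumerate the squares, \<open>n\<close> is the
    row and \<open>n + 1\<close> the column.\<close>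
  define g where "g i = (if i < n then h i else if i = n then fst else snd)" for i
  have hS: "h i \<in> S" if "i \<in> {1..n+1}" "i < n" for i
    using h that by (auto simp: bij_betw_def)
  have row: "c = c'" if "L \<in> S" "(r, c) \<in> ?V" "(r, c') \<in> ?V" "L (r, c) = L (r, c')" for L r c c'
  proof -
    have "inj_on (\<lambda>c. L (r, c)) {1..n}"
      using S(3)[OF that(1)] that(2) unfolding latin_square_def bij_betw_def by auto
    then show ?thesis using that by (auto dest: inj_onD)
  qed
  have col: "r = r'" if "L \<in> S" "(r, c) \<in> ?V" "(r', c) \<in> ?V" "L (r, c) = L (r', c)" for L r r' c
  proof -
    have "inj_on (\<lambda>r. L (r, c)) {1..n}"
      using S(3)[OF that(1)] that(2) unfolding latin_square_def bij_betw_def by auto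
    then show ?thesis using that by (auto dest: inj_onD)
  qed
  have into: "g i \<in> ?V \<rightarrow> {1..n}" if i: "i \<in> {1..n+1}" for i
    using S(3)[OF hS[OF i]] unfolding g_def latin_square_def PiE_def by auto
  have inj: "p = q"
    if H: "i \<in> {1..n+1}" "j \<in> {1..n+1}" "i < j" "p \<in> ?V" "q \<in> ?V" "g i p = g i q" "g j p = g j q"
    for i j p q
  proof -
    obtain r c r' c' where pq: "p = (r, c)" "q = (r', c')" by (cases p, cases q)
    consider "i < n" "j < n" | "i < n" "j = n" | "i < n" "j = n + 1" | "i = n" "j = n + 1"
      using H(2,3) by force
    then show ?thesis
    proof cases
      case 1
      then have "h i \<noteq> h j"
        using h H(1-3) unfolding bij_betw_def inj_on_def by fastforce
      then have "inj_on (\<lambda>p. (h i p, h j p)) ?V"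
        using orth hS H 1 unfolding orthogonal_squares_def bij_betw_def by blast
      then show ?thesis using H 1 by (auto simp: g_def dest: inj_onD)
    next
      case 2
      then show ?thesis using row[OF hS] H pq by (auto simp: g_def)
    next
      case 3
      then show ?thesis using col[OF hS] H pq by (auto simp: g_def)
    next
      case 4
      then show ?thesis using H pq by (auto simp: g_def)
    qed
  qed
  have "inj_on (\<lambda>p. (g i p, g j p)) ?V"
    if "i \<in> {1..n+1}" "j \<in> {1..n+1}" "i \<noteq> j" for i j
  proof (rule inj_onI)
    fix p q assume "p \<in> ?V" "q \<in> ?V" "(g i p, g j p) = (g i q, g j q)"
    then show "p = q"
      using inj[of i j p q] inj[of j i p q] that by (cases i j rule: linorder_cases) auto
  qed
  with into have "orthogonal_labels n (n + 1) ?V g"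
    unfolding orthogonal_labels_def by simp
  then show ?thesis by blast
qed

lemma orthogonal_labels_reindex:
  assumes "orthogonal_labels n k V g" "bij_betw h W V"
  shows "orthogonal_labels n k W (\<lambda>i. g i \<circ> h)"
proof -
  have "inj_on (\<lambda>x. (g i (h x), g j (h x))) W"
    if "i \<in> {1..k}" "j \<in> {1..k}" "i \<noteq> j" for i j
    using comp_inj_on[of h W "\<lambda>x. (g i x, g j x)"] assms that
    unfolding orthogonal_labels_def bij_betw_def comp_def by auto
  moreover have "g i \<circ> h \<in> W \<rightarrow> {1..n}" if "i \<in> {1..k}" for i
    using assms that unfolding orthogonal_labels_def bij_betw_def by fastforce
  ultimately show ?thesis unfolding orthogonal_labels_def by simp
qed

text \<open>An injection between finite sets of the same size \<open>n\<^sup>2\<close> is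
  onto.\<close>

lemma orthogonal_labels_bij:
  assumes "orthogonal_labels n k V g" "finite V" "card V = n\<^sup>2"
    and "i \<in> {1..k}" "j \<in> {1..k}" "i \<noteq> j"
  shows "bij_betw (\<lambda>x. (g i x, g j x)) V ({1..n} \<times> {1..n})"
proof -
  have inj: "inj_on (\<lambda>x. (g i x, g j x)) V"
    using assms unfolding orthogonal_labels_def by blast
  moreover have "(\<lambda>x. (g i x, g j x)) ` V \<subseteq> {1..n} \<times> {1..n}"
    using assms unfolding orthogonal_labels_def by blast
  moreover have "card ((\<lambda>x. (g i x, g j x)) ` V) = card ({1..n} \<times> {1..n})"
    using inj assms(3) by (simp add: card_image power2_eq_square)
  ultimately show ?thesis
    unfolding bij_betw_def by (simp add: card_subset_eq)
qed

text \<open>The last two labels identify \<open>V\<close> with the cells of an \<open>n\<close> by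
  \<open>n\<close> grid; each remaining label, read as a function of the cell, is a square of the
  family.\<close>

lemma MOLS_of_orthogonal_labels:
  assumes "0 < n" and g: "orthogonal_labels n (n + 1) V g" and V: "finite V" "card V = n\<^sup>2"
  shows "\<exists>S. complete_MOLS n S"
proof -
  let ?B = "{1..n} \<times> {1..n}"
  let ?c = "\<lambda>x. (g n x, g (n + 1) x)"
  have c: "bij_betw ?c V ?B"
    using assms(1) by (intro orthogonal_labels_bij[OF g V]) auto
  define w where "w = inv_into V ?c"
  have w: "bij_betw w ?B V" unfolding w_def by (rule bij_betw_inv_into[OF c])
  have coords: "g n (w (r, s)) = r" "g (n + 1) (w (r, s)) = s" if "(r, s) \<in> ?B" for r s
    using bij_betw_inv_into_right[OF c that] unfolding w_def by simp_all
  define G where "G = (\<lambda>i. g i \<circ> w)"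
  have G: "orthogonal_labels n (n + 1) ?B G"
    unfolding G_def by (rule orthogonal_labels_reindex[OF g w])
  have Gn: "G n (r, s) = r" "G (n + 1) (r, s) = s" if "(r, s) \<in> ?B" for r s
    using coords[OF that] by (simp_all add: G_def)
  have Ginto: "G i p \<in> {1..n}" if "i \<in> {1..<n}" "p \<in> ?B" for i p
    using G that unfolding orthogonal_labels_def by (auto simp: Pi_iff)
  have Ginj: "inj_on (\<lambda>p. (G i p, G j p)) ?B"
    if "i \<in> {1..n+1}" "j \<in> {1..n+1}" "i \<noteq> j" for i j
    using G that unfolding orthogonal_labels_def by blast
  \<comment> \<open>Latin squares are extensional functions, hence the restriction.\<close>
  define L where "L i = restrict (G i) ?B" for i
  have L_eq: "L i p = G i p" if "p \<in> ?B" for i p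
    using that by (simp add: L_def)
  have latin: "latin_square n (L i)" if i: "i \<in> {1..<n}" for i
  proof -
    have "bij_betw (\<lambda>s. L i (r, s)) {1..n} {1..n}" if r: "r \<in> {1..n}" for r
    proof -
      have "inj_on (\<lambda>s. L i (r, s)) {1..n}"
      proof (rule inj_onI)
        fix s s' assume s: "s \<in> {1..n}" "s' \<in> {1..n}" "L i (r, s) = L i (r, s')"
        \<comment> \<open>Label \<open>n\<close> is constant along a row, so equal entries would
          give two cells agreeing in labels \<open>i\<close> and \<open>n\<close>. Columns are
          treated alike with label \<open>n + 1\<close>.\<close>
        have "(r, s) = (r, s')"
          by (rule inj_onD[OF Ginj[of i n]]) (use i r s Gn L_eq in auto)
        then show "s = s'" by simp
      qed
      moreover have "(\<lambda>s. L i (r, s)) ` {1..n} \<subseteq> {1..n}"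
        using Ginto[OF i] L_eq r by auto
      ultimately show ?thesis by (simp add: bij_betw_def endo_inj_surj)
    qed
    moreover have "bij_betw (\<lambda>r. L i (r, s)) {1..n} {1..n}" if s: "s \<in> {1..n}" for s
    proof -
      have "inj_on (\<lambda>r. L i (r, s)) {1..n}"
      proof (rule inj_onI)
        fix r r' assume r: "r \<in> {1..n}" "r' \<in> {1..n}" "L i (r, s) = L i (r', s)"
        have "(r, s) = (r', s)"
          by (rule inj_onD[OF Ginj[of i "n + 1"]]) (use i r s Gn L_eq in auto)
        then show "r = r'" by simp
      qed
      moreover have "(\<lambda>r. L i (r, s)) ` {1..n} \<subseteq> {1..n}"
        using Ginto[OF i] L_eq s by auto
      ultimately show ?thesis by (simp add: bij_betw_def endo_inj_surj)
    qed
    moreover have "L i \<in> ?B \<rightarrow>\<^sub>E {1..n}"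
      using Ginto[OF i] unfolding L_def by (simp add: restrict_PiE_iff)
    ultimately show ?thesis unfolding latin_square_def by blast
  qed
  have orth: "orthogonal_squares n (L i) (L j)" if "i \<in> {1..<n}" "j \<in> {1..<n}" "i \<noteq> j" for i j
  proof -
    have "bij_betw (\<lambda>p. (G i p, G j p)) ?B ?B"
      by (rule orthogonal_labels_bij[OF G]) (use that in \<open>auto simp: power2_eq_square\<close>)
    then show ?thesis
      unfolding orthogonal_squares_def using L_eq by (subst bij_betw_cong) auto
  qed
  have "inj_on L {1..<n}"
  proof (rule inj_onI, rule ccontr)
    fix i j assume ij: "i \<in> {1..<n}" "j \<in> {1..<n}" "L i = L j" "i \<noteq> j"
    \<comment> \<open>An index in \<open>{1..<n}\<close> forces \<open>n \<ge> 2\<close>. Orthogonal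
      squares realise the pair \<open>(1, 2)\<close>, which a square paired with itself cannot; so
      the squares are distinct and there are \<open>n - 1\<close> of them.\<close>
    have "(1, 2) \<in> ?B" using ij(1) by auto
    then have "(1, 2) \<in> (\<lambda>p. (L i p, L j p)) ` ?B"
      using orth[OF ij(1,2,4)] unfolding orthogonal_squares_def bij_betw_def by metis
    then show False using ij(3) by auto
  qed
  then have "card (L ` {1..<n}) = n - 1" by (simp add: card_image)
  moreover have "pairwise (orthogonal_squares n) (L ` {1..<n})"
    unfolding pairwise_def using orth by blast
  ultimately have "complete_MOLS n (L ` {1..<n})"
    using latin unfolding complete_MOLS_def by blast
  then show ?thesis ..
qed

section \<open>Extremal colorings and the value of the Ramsey number\<close>

lemma complete_MOLS_iff_coloring:
  assumes "0 < n"
  shows "(\<exists>S. complete_MOLS n S) \<longleftrightarrow>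
    (\<exists>f. edge_coloring (n\<^sup>2) (n + 1) f \<and> (\<forall>i\<in>{1..n+1}. color_alpha (n\<^sup>2) f i < n + 1))"
    (is "?M \<longleftrightarrow> ?C")
proof
  assume ?M
  then obtain g where g: "orthogonal_labels n (n + 1) ({1..n} \<times> {1..n}) g"
    using orthogonal_labels_of_MOLS[OF assms] by blast
  have "card {1..n\<^sup>2} = card ({1..n} \<times> {1..n})" by (simp add: power2_eq_square)
  then obtain h where "bij_betw h {1..n\<^sup>2} ({1..n} \<times> {1..n})"
    using finite_same_card_bij[of "{1..n\<^sup>2}" "{1..n} \<times> {1..n}"] by auto
  from orthogonal_labels_reindex[OF g this] show ?C
    by (rule coloring_of_orthogonal_labels) simp
next
  assume ?C
  then obtain g where "orthogonal_labels n (n + 1) {1..n\<^sup>2} g"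
    using orthogonal_labels_of_coloring[OF assms] by blast
  then show ?M by (rule MOLS_of_orthogonal_labels[OF assms]) simp_all
qed

text \<open>Deleting vertices keeps the coloring good: an independent set among the remaining
  vertices was independent before.\<close>

lemma coloring_restrict:
  assumes "M \<le> N" "edge_coloring N k f" "\<forall>i\<in>{1..k}. color_alpha N f i < m"
  shows "edge_coloring M k f \<and> (\<forall>i\<in>{1..k}. color_alpha M f i < m)"
proof -
  have sub: "{1..M} \<subseteq> {1..N}" using assms(1) by simp
  then have "[{1..M}]\<^bsup>2\<^esup> \<subseteq> [{1..N}]\<^bsup>2\<^esup>" by (rule nsets_mono)
  then show ?thesis
    using assms(2,3) sub unfolding edge_coloring_def color_alpha_less_iff by blast
qed

theorem theorem5p5:
  fixes n :: nat
  assumes "0 < n"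
  shows "(\<exists>S. complete_MOLS n S) \<longleftrightarrow> Rbar_diag (n + 1) (n + 1) = n\<^sup>2 + 1"
proof -
  define avoids where "avoids N \<longleftrightarrow>
    (\<exists>f. edge_coloring N (n + 1) f \<and> (\<forall>i\<in>{1..n+1}. color_alpha N f i < n + 1))" for N
  have Rbar: "Rbar_diag (n + 1) (n + 1) = (LEAST N. 0 < N \<and> \<not> avoids N)"
    unfolding Rbar_diag_def Rbar_def avoids_def by (simp only: not_le[symmetric]) simp
  \<comment> \<open>A good coloring has at most \<open>n\<^sup>2\<close> vertices, so the least bad
    order is at most \<open>n\<^sup>2 + 1\<close> in any case; only the order
    \<open>n\<^sup>2\<close> remains to be decided.\<close>
  have ub: "\<not> avoids (n\<^sup>2 + 1)"
    unfolding avoids_def using coloring_order_le_square by fastforce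
  have "avoids (n\<^sup>2) \<longleftrightarrow> (LEAST N. 0 < N \<and> \<not> avoids N) = n\<^sup>2 + 1"
  proof
    assume "avoids (n\<^sup>2)"
    then have down: "avoids N" if "N \<le> n\<^sup>2" for N
      unfolding avoids_def using coloring_restrict[OF that] by blast
    show "(LEAST N. 0 < N \<and> \<not> avoids N) = n\<^sup>2 + 1"
      by (rule Least_equality) (use ub down in \<open>force simp: not_less_eq_eq[symmetric]\<close>)+
  next
    assume "(LEAST N. 0 < N \<and> \<not> avoids N) = n\<^sup>2 + 1"
    \<comment> \<open>The order \<open>n\<^sup>2\<close> lies below the least bad positive order,
      and it is positive, so it must be good.\<close>
    then have "\<not> (0 < n\<^sup>2 \<and> \<not> avoids (n\<^sup>2))" by (intro not_less_Least) simp
    then show "avoids (n\<^sup>2)" using assms by simp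
  qed
  then show ?thesis
    using complete_MOLS_iff_coloring[OF assms] Rbar unfolding avoids_def by simp
qed

end
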